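(* Let $X$ be a chain. Then $\mathcal{POP}(X)$ is a submonoid of $\mathcal{PT}(X)$. Consequently, $\mathcal{OP}(X)$ is a submonoid of $\mathcal{T}(X)$ (and of $\mathcal{POP}(X)$ and of $\mathcal{PT}(X)$).
   Context: $X$ is a chain (totally ordered set), finite or infinite. $\mathcal{PT}(X)$ is the monoid of all partial transformations of $X$ (including the empty one) under composition of partial maps, written on the right: $x(\alpha\beta)=(x\alpha)\beta$, with $\mathrm{Dom}(\alpha\beta)=\{x\in\mathrm{Dom}(\alpha)\mid x\alpha\in\mathrm{Dom}(\beta)\}$. $\mathcal{T}(X)$ is its submonoid of all full transformations (those with domain $X$). $\alpha\in\mathcal{PT}(X)$ is order-preserving on $Y\subseteq\mathrm{Dom}(\alpha)$ if $x\le y$ implies $x\alpha\le y\alpha$ for all $x,y\in Y$. $\alpha\in\mathcal{PT}(X)$ is orientation-preserving if it is the empty transformation or there exists a non-empty subset $Y$ of $\mathrm{Dom}(\alpha)$ such that: (OP1) $\alpha$ is order-preserving both on $Y$ and on $\mathrm{Dom}(\alpha)\setminus Y$; (OP2) for all $a\in Y$ and $b\in\mathrm{Dom}(\alpha)\setminus Y$, $a\le b$ and $a\alpha\ge b\alpha$. $\mathcal{POP}(X)$ is the set of all orientation-preserving elements of $\mathcal{PT}(X)$, and $\mathcal{OP}(X)=\mathcal{POP}(X)\cap\mathcal{T}(X)$. *)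

theory Defs
  imports "HOL-Algebra.Group"
begin

text \<open>
  A chain is a set \<open>X\<close>, possibly empty, with a relation \<open>r\<close> such that \<^term>\<open>linear_order_on X r\<close>;
  \<^term>\<open>(x, y) \<in> r\<close> means \<open>x \<le> y\<close>.  A partial transformation of \<open>X\<close> is a map with domain and
  range contained in \<open>X\<close>.
\<close>

text \<open>
  Maps act on the right: the product of \<open>\<alpha>\<close> and \<open>\<beta>\<close> applies \<open>\<alpha>\<close> first, whence the swapped
  arguments of \<open>\<circ>\<^sub>m\<close>.
\<close>

definition PT :: "'a set \<Rightarrow> ('a \<rightharpoonup> 'a) monoid"
  where "PT X =
    \<lparr>carrier = {\<alpha>. dom \<alpha> \<subseteq> X \<and> ran \<alpha> \<subseteq> X},
     mult = (\<lambda>\<alpha> \<beta>. \<beta> \<circ>\<^sub>m \<alpha>),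
     one = (\<lambda>x. if x \<in> X then Some x else None)\<rparr>"

definition full_transformations :: "'a set \<Rightarrow> ('a \<rightharpoonup> 'a) set"
  where "full_transformations X = {\<alpha> \<in> carrier (PT X). dom \<alpha> = X}"

definition T :: "'a set \<Rightarrow> ('a \<rightharpoonup> 'a) monoid"
  where "T X = (PT X)\<lparr>carrier := full_transformations X\<rparr>"

text \<open>Only meaningful for \<^term>\<open>Y \<subseteq> dom \<alpha>\<close>.\<close>

definition order_preserving_on :: "'a rel \<Rightarrow> 'a set \<Rightarrow> ('a \<rightharpoonup> 'a) \<Rightarrow> bool"
  where "order_preserving_on r Y \<alpha> \<longleftrightarrow>
    monotone_on Y (\<lambda>x y. (x, y) \<in> r) (\<lambda>x y. (x, y) \<in> r) (\<lambda>x. the (\<alpha> x))"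

definition orientation_preserving :: "'a rel \<Rightarrow> ('a \<rightharpoonup> 'a) \<Rightarrow> bool"
  where "orientation_preserving r \<alpha> \<longleftrightarrow>
    \<alpha> = Map.empty \<or>
    (\<exists>Y. Y \<noteq> {} \<and> Y \<subseteq> dom \<alpha> \<and>
      order_preserving_on r Y \<alpha> \<and> order_preserving_on r (dom \<alpha> - Y) \<alpha> \<and>
      (\<forall>a\<in>Y. \<forall>b\<in>dom \<alpha> - Y. (a, b) \<in> r \<and> (the (\<alpha> b), the (\<alpha> a)) \<in> r))"

definition POP :: "'a set \<Rightarrow> 'a rel \<Rightarrow> ('a \<rightharpoonup> 'a) set"
  where "POP X r = {\<alpha> \<in> carrier (PT X). orientation_preserving r \<alpha>}"

definition OP :: "'a set \<Rightarrow> 'a rel \<Rightarrow> ('a \<rightharpoonup> 'a) set"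
  where "OP X r = POP X r \<inter> carrier (T X)"

text \<open>The locale \<^locale>\<open>submonoid\<close> does not require the ambient structure to be a monoid.\<close>

lemma monoid_PT: "monoid (PT X)"
proof (rule monoidI, goal_cases)
  case (1 \<alpha> \<beta>)
  then show ?case
    by (force simp: PT_def ran_def dom_def map_comp_Some_iff)
next
  case 2
  then show ?case
    by (auto simp: PT_def ran_def split: if_splits)
next
  case (3 \<alpha> \<beta> \<gamma>)
  then show ?case
    by (auto simp: PT_def map_comp_def fun_eq_iff split: option.splits)
next
  case (4 \<alpha>)
  then have "\<alpha> x = None" if "x \<notin> X" for x
    using that by (auto simp: PT_def)
  then show ?case
    by (auto simp: PT_def map_comp_def fun_eq_iff)
next
  case (5 \<alpha>)
  then show ?case
    by (auto simp: PT_def map_comp_def fun_eq_iff ran_def split: option.splits)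
qed

lemma submonoid_full_transformations: "submonoid (full_transformations X) (PT X)"
proof
  fix \<alpha> \<beta>
  assume *: "\<alpha> \<in> full_transformations X" "\<beta> \<in> full_transformations X"
  then have "\<alpha> \<otimes>\<^bsub>PT X\<^esub> \<beta> \<in> carrier (PT X)"
    by (auto simp: full_transformations_def intro: monoid.m_closed[OF monoid_PT])
  moreover have "\<exists>z. (\<alpha> \<otimes>\<^bsub>PT X\<^esub> \<beta>) x = Some z" if "x \<in> X" for x
  proof -
    from * that obtain y where y: "\<alpha> x = Some y"
      by (auto simp: full_transformations_def)
    with * have "y \<in> dom \<beta>"
      by (auto simp: full_transformations_def PT_def intro: ranI)
    with y show ?thesis
      by (auto simp: PT_def)
  qed
  ultimately have "\<alpha> \<otimes>\<^bsub>PT X\<^esub> \<beta> \<in> carrier (PT X) \<and> dom (\<alpha> \<otimes>\<^bsub>PT X\<^esub> \<beta>) = X"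
    by (auto simp: PT_def)
  then show "\<alpha> \<otimes>\<^bsub>PT X\<^esub> \<beta> \<in> full_transformations X"
    by (simp add: full_transformations_def)
qed (auto simp: full_transformations_def PT_def ran_def split: if_splits)

lemma monoid_T: "monoid (T X)"
  unfolding T_def
  by (rule submonoid.submonoid_is_monoid[OF submonoid_full_transformations monoid_PT])

end

theory Submission
  imports Defs
begin

text \<open>
  Call \<open>Y\<close> a cut of \<open>\<alpha>\<close> if it witnesses that \<open>\<alpha>\<close> is orientation-preserving, where \<open>Y = {}\<close> is
  also allowed.  Suppose that \<open>Y\<close> is a cut of \<open>\<alpha>\<close> with \<open>Z = dom \<alpha> - Y\<close>, and \<open>U\<close> a cut of
  \<open>\<beta>\<close> with \<open>V = dom \<beta> - U\<close>.  The domain of the product \<open>\<alpha>\<beta>\<close> falls into four consecutive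
  blocks \<open>Y\<^sub>U < Y\<^sub>V < Z\<^sub>U < Z\<^sub>V\<close>, where the letter says which half of \<open>dom \<alpha>\<close> contains the points
  and the index says which half of \<open>dom \<beta>\<close> contains their images under \<open>\<alpha>\<close>.  As \<open>\<alpha>\<close> sends
  \<open>Z\<close> below \<open>Y\<close> while \<open>U\<close> lies below \<open>V\<close>, the blocks \<open>Y\<^sub>U\<close> and \<open>Z\<^sub>V\<close> cannot both be
  non-empty.

  The product preserves the order on each block, and also across the border from \<open>Y\<^sub>V\<close> to
  \<open>Z\<^sub>U\<close>, because \<open>\<beta>\<close> sends \<open>V\<close> below \<open>U\<close>.  The only descent left lies at the end of
  \<open>Y\<^sub>U\<close> if \<open>Z\<^sub>V\<close> is empty, and at the beginning of \<open>Z\<^sub>V\<close> if \<open>Y\<^sub>U\<close> is empty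
  (lemma \<open>orientation_cut_map_comp\<close>).
\<close>

text \<open>
  With the empty cut allowed, neither the empty transformation nor a product whose first part
  happens to be empty has to be treated separately.
\<close>

definition orientation_cut :: "'a rel \<Rightarrow> ('a \<rightharpoonup> 'a) \<Rightarrow> 'a set \<Rightarrow> bool"
  where "orientation_cut r \<alpha> Y \<longleftrightarrow>
    Y \<subseteq> dom \<alpha> \<and> order_preserving_on r Y \<alpha> \<and> order_preserving_on r (dom \<alpha> - Y) \<alpha> \<and>
    (\<forall>a\<in>Y. \<forall>b\<in>dom \<alpha> - Y. (a, b) \<in> r \<and> (the (\<alpha> b), the (\<alpha> a)) \<in> r)"

text \<open>An empty cut means that \<open>\<alpha>\<close> is order-preserving, and then \<open>dom \<alpha>\<close> is a cut as well.\<close>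

lemma orientation_preserving_iff_cut:
  "orientation_preserving r \<alpha> \<longleftrightarrow> (\<exists>Y. orientation_cut r \<alpha> Y)"
proof
  assume "orientation_preserving r \<alpha>"
  moreover have "orientation_cut r Map.empty {}"
    by (simp add: orientation_cut_def order_preserving_on_def monotone_on_def)
  ultimately show "\<exists>Y. orientation_cut r \<alpha> Y"
    unfolding orientation_preserving_def orientation_cut_def by blast
next
  assume "\<exists>Y. orientation_cut r \<alpha> Y"
  then obtain Y where Y: "orientation_cut r \<alpha> Y" ..
  show "orientation_preserving r \<alpha>"
  proof (cases "\<alpha> = Map.empty")
    case False
    then have "dom \<alpha> \<noteq> {}"
      by simp
    moreover have "orientation_cut r \<alpha> (dom \<alpha>)" if "Y = {}"
      using Y that by (simp add: orientation_cut_def order_preserving_on_def monotone_on_def)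
    ultimately have "\<exists>Y. Y \<noteq> {} \<and> orientation_cut r \<alpha> Y"
      using Y by metis
    then show ?thesis
      unfolding orientation_preserving_def orientation_cut_def by simp
  qed (simp add: orientation_preserving_def)
qed

lemma order_preserving_on_Un:
  assumes "antisym r" "A \<inter> B = {}"
    and "order_preserving_on r A \<alpha>" "order_preserving_on r B \<alpha>"
    and "\<And>a b. a \<in> A \<Longrightarrow> b \<in> B \<Longrightarrow> (a, b) \<in> r \<and> (the (\<alpha> a), the (\<alpha> b)) \<in> r"
  shows "order_preserving_on r (A \<union> B) \<alpha>"
  unfolding order_preserving_on_def
proof (rule monotone_onI)
  fix x y
  assume xy: "x \<in> A \<union> B" "y \<in> A \<union> B" "(x, y) \<in> r"
  have "\<not> (x \<in> B \<and> y \<in> A)"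
    using assms(1,2,5) xy(3) by (metis antisymD disjoint_iff)
  with xy consider "x \<in> A" "y \<in> A" | "x \<in> B" "y \<in> B" | "x \<in> A" "y \<in> B"
    by blast
  then show "(the (\<alpha> x), the (\<alpha> y)) \<in> r"
    using assms(3-5) xy(3) by cases (auto simp: order_preserving_on_def monotone_on_def)
qed

lemma orientation_cut_map_comp:
  assumes lin: "linear_order_on X r"
    and dom\<alpha>: "dom \<alpha> \<subseteq> X"
    and Y: "orientation_cut r \<alpha> Y" and U: "orientation_cut r \<beta> U"
  shows "\<exists>W. orientation_cut r (\<beta> \<circ>\<^sub>m \<alpha>) W"
proof -
  define f where "f x = the (\<alpha> x)" for x
  define g where "g x = the (\<beta> x)" for x
  define \<gamma> where "\<gamma> = \<beta> \<circ>\<^sub>m \<alpha>"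
  define Z where "Z = dom \<alpha> - Y"
  define V where "V = dom \<beta> - U"
  have anti: "antisym r" and total: "total_on X r" and refl: "refl_on X r"
    using lin by (auto simp: order_on_defs)
  have sub: "Y \<subseteq> dom \<alpha>" "Z \<subseteq> dom \<alpha>" and YX: "Y \<subseteq> X" "Z \<subseteq> X"
    using Y dom\<alpha> by (auto simp: orientation_cut_def Z_def)
  have f_mono: "(f x, f y) \<in> r" if "x \<in> Y \<and> y \<in> Y \<or> x \<in> Z \<and> y \<in> Z" "(x, y) \<in> r" for x y
    using Y that
    unfolding orientation_cut_def order_preserving_on_def monotone_on_def f_def Z_def by blast
  have g_mono: "(g x, g y) \<in> r" if "x \<in> U \<and> y \<in> U \<or> x \<in> V \<and> y \<in> V" "(x, y) \<in> r" for x y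
    using U that
    unfolding orientation_cut_def order_preserving_on_def monotone_on_def g_def V_def by blast
  have YZ: "(y, z) \<in> r" "(f z, f y) \<in> r" if "y \<in> Y" "z \<in> Z" for y z
    using Y that unfolding orientation_cut_def f_def Z_def by blast+
  have UV: "(u, v) \<in> r" "(g v, g u) \<in> r" if "u \<in> U" "v \<in> V" for u v
    using U that unfolding orientation_cut_def g_def V_def by blast+
  have VU: "(v, u) \<notin> r" if "u \<in> U" "v \<in> V" for u v
    using UV[OF that] that anti by (auto simp: V_def dest: antisymD)

  define YU where "YU = {x \<in> Y. f x \<in> U}"
  define YV where "YV = {x \<in> Y. f x \<in> V}"
  define ZU where "ZU = {x \<in> Z. f x \<in> U}"
  define ZV where "ZV = {x \<in> Z. f x \<in> V}"
  note blocks = YU_def YV_def ZU_def ZV_def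
  have "dom \<gamma> = {x \<in> dom \<alpha>. f x \<in> dom \<beta>}"
    by (auto simp: \<gamma>_def f_def map_comp_def split: option.splits)
  also have "\<dots> = YU \<union> YV \<union> ZU \<union> ZV"
    using sub U by (auto simp: blocks Z_def V_def orientation_cut_def)
  finally have dom\<gamma>: "dom \<gamma> = YU \<union> YV \<union> ZU \<union> ZV" .
  have \<gamma>: "the (\<gamma> x) = g (f x)" if "x \<in> dom \<gamma>" for x
    using that by (auto simp: \<gamma>_def f_def g_def map_comp_def split: option.splits)
  have disj: "YU \<inter> YV = {}" "YU \<inter> ZU = {}" "YV \<inter> ZU = {}" "YV \<inter> ZV = {}" "ZU \<inter> ZV = {}"
    by (auto simp: blocks Z_def V_def)
  have on_block: "order_preserving_on r B \<gamma>" if "B \<in> {YU, YV, ZU, ZV}" for B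
  proof -
    have "(the (\<gamma> x), the (\<gamma> y)) \<in> r" if "x \<in> B" "y \<in> B" "(x, y) \<in> r" for x y
    proof -
      have "x \<in> dom \<gamma>" "y \<in> dom \<gamma>"
        using that \<open>B \<in> _\<close> dom\<gamma> by auto
      moreover have "(g (f x), g (f y)) \<in> r"
        using that \<open>B \<in> _\<close> by (intro g_mono f_mono) (auto simp: blocks)
      ultimately show ?thesis
        by (simp add: \<gamma>)
    qed
    then show ?thesis
      by (simp add: order_preserving_on_def monotone_on_def)
  qed

  \<comment> \<open>Inside one half of \<open>dom \<alpha>\<close>, points sent to \<open>U\<close> precede points sent to \<open>V\<close>.\<close>
  have U_before_V: "(x, y) \<in> r" if "x \<in> YU \<and> y \<in> YV \<or> x \<in> ZU \<and> y \<in> ZV" for x y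
  proof (rule ccontr)
    assume "(x, y) \<notin> r"
    moreover have "x \<in> X" "y \<in> X"
      using that YX by (auto simp: blocks)
    ultimately have "(y, x) \<in> r"
      using total refl unfolding total_on_def refl_on_def by metis
    with that have "(f y, f x) \<in> r"
      by (intro f_mono) (auto simp: blocks)
    with that VU show False
      unfolding blocks by blast
  qed
  have V_below_U: "(the (\<gamma> x), the (\<gamma> y)) \<in> r" if "x \<in> YV \<union> ZV" "y \<in> YU \<union> ZU" for x y
  proof -
    have "(g (f x), g (f y)) \<in> r"
      using that by (intro UV(2)) (auto simp: blocks)
    moreover have "x \<in> dom \<gamma>" "y \<in> dom \<gamma>"
      using that unfolding dom\<gamma> by auto
    ultimately show ?thesis
      by (simp add: \<gamma>)
  qed
  have Z_below_Y: "(the (\<gamma> z), the (\<gamma> y)) \<in> r"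
    if "y \<in> YU \<and> z \<in> ZU \<or> y \<in> YV \<and> z \<in> ZV" for y z
  proof -
    have "(g (f z), g (f y)) \<in> r"
      using that by (intro g_mono YZ(2)) (auto simp: blocks)
    moreover have "y \<in> dom \<gamma>" "z \<in> dom \<gamma>"
      using that unfolding dom\<gamma> by auto
    ultimately show ?thesis
      by (simp add: \<gamma>)
  qed
  have middle: "order_preserving_on r (YV \<union> ZU) \<gamma>"
  proof (rule order_preserving_on_Un[OF anti \<open>YV \<inter> ZU = {}\<close>])
    show "(a, b) \<in> r \<and> (the (\<gamma> a), the (\<gamma> b)) \<in> r" if "a \<in> YV" "b \<in> ZU" for a b
      using that V_below_U[of a b] YZ(1)[of a b] by (simp add: YV_def ZU_def)
  qed (simp_all add: on_block)

  have "YU = {} \<or> ZV = {}"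
    using VU YZ(2) unfolding blocks by blast
  then show ?thesis
  proof
    assume "YU = {}"
    with disj have rest: "dom \<gamma> - (YV \<union> ZU) = ZV"
      unfolding dom\<gamma> by auto
    have "(a, b) \<in> r \<and> (the (\<gamma> b), the (\<gamma> a)) \<in> r" if "a \<in> YV \<union> ZU" "b \<in> ZV" for a b
      using that U_before_V[of a b] V_below_U[of b a] Z_below_Y[of a b] YZ(1)[of a b]
      by (auto simp: YV_def ZV_def)
    then have "orientation_cut r \<gamma> (YV \<union> ZU)"
      unfolding orientation_cut_def rest using middle on_block dom\<gamma> by auto
    then show ?thesis
      unfolding \<gamma>_def ..
  next
    assume "ZV = {}"
    with disj have rest: "dom \<gamma> - YU = YV \<union> ZU"
      unfolding dom\<gamma> by auto
    have "(a, b) \<in> r \<and> (the (\<gamma> b), the (\<gamma> a)) \<in> r" if "a \<in> YU" "b \<in> YV \<union> ZU" for a b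
      using that U_before_V[of a b] V_below_U[of b a] Z_below_Y[of a b] YZ(1)[of a b]
      by (auto simp: YU_def ZU_def)
    then have "orientation_cut r \<gamma> YU"
      unfolding orientation_cut_def rest using middle on_block dom\<gamma> by auto
    then show ?thesis
      unfolding \<gamma>_def ..
  qed
qed

lemma submonoid_POP:
  assumes "linear_order_on X r"
  shows "submonoid (POP X r) (PT X)"
proof
  show "POP X r \<subseteq> carrier (PT X)"
    by (auto simp: POP_def)
next
  fix \<alpha> \<beta>
  assume "\<alpha> \<in> POP X r" "\<beta> \<in> POP X r"
  moreover from this have "\<alpha> \<otimes>\<^bsub>PT X\<^esub> \<beta> \<in> carrier (PT X)"
    by (auto simp: POP_def intro: monoid.m_closed[OF monoid_PT])
  ultimately show "\<alpha> \<otimes>\<^bsub>PT X\<^esub> \<beta> \<in> POP X r"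
    using orientation_cut_map_comp[OF assms, of \<alpha> _ \<beta>]
    by (auto simp: POP_def PT_def orientation_preserving_iff_cut)
next
  have "orientation_cut r \<one>\<^bsub>PT X\<^esub> {}"
    by (auto simp: orientation_cut_def order_preserving_on_def monotone_on_def PT_def
        split: if_splits)
  then show "\<one>\<^bsub>PT X\<^esub> \<in> POP X r"
    using monoid.one_closed[OF monoid_PT]
    by (auto simp: POP_def orientation_preserving_iff_cut)
qed

lemma submonoid_Int:
  assumes "submonoid H G" "submonoid K G"
  shows "submonoid (H \<inter> K) G"
  using assms by (auto simp: submonoid_def)

lemma submonoid_subset:
  assumes "submonoid H G" "H \<subseteq> K"
  shows "submonoid H (G\<lparr>carrier := K\<rparr>)"
  using assms by (auto simp: submonoid_def)

theorem proposition1p6: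
  fixes X :: "'a set" and r :: "'a rel"
  assumes "linear_order_on X r"
  shows "submonoid (POP X r) (PT X) \<and>
    submonoid (OP X r) (T X) \<and>
    submonoid (OP X r) ((PT X)\<lparr>carrier := POP X r\<rparr>) \<and>
    submonoid (OP X r) (PT X)"
proof -
  have OP_eq: "OP X r = POP X r \<inter> full_transformations X"
    by (simp add: OP_def T_def)
  have POP: "submonoid (POP X r) (PT X)"
    using assms by (rule submonoid_POP)
  then have OP: "submonoid (OP X r) (PT X)"
    unfolding OP_eq by (rule submonoid_Int[OF _ submonoid_full_transformations])
  have "submonoid (OP X r) (T X)"
    unfolding T_def using OP by (rule submonoid_subset) (simp add: OP_eq)
  moreover have "submonoid (OP X r) ((PT X)\<lparr>carrier := POP X r\<rparr>)"
    using OP by (rule submonoid_subset) (simp add: OP_eq)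
  ultimately show ?thesis
    using POP OP by simp
qed

end
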